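(* Let $N$ be the number of sensors and let $\hat{\boldsymbol{w}}=\boldsymbol{1}/\sqrt{N}\in\mathbb{R}^N$, where $\boldsymbol{1}=(1,\dots,1)$. Let $|\Phi_N^+\rangle=(|0\rangle^{\otimes N}+|1\rangle^{\otimes N})/\sqrt2$ be the $N$-qubit GHZ state. For the probe state $|\psi_0\rangle=|\Phi_N^+\rangle$, $$\mathcal{F}_Q(\hat{\boldsymbol{w}}^\top\boldsymbol{\theta})=N,\qquad \mathcal{F}_Q(\hat{\boldsymbol{v}}^\top\boldsymbol{\theta})=0\quad\text{for all unit vectors }\hat{\boldsymbol{v}}\in\mathbb{R}^N\text{ with }\hat{\boldsymbol{v}}\perp\hat{\boldsymbol{w}}.\qquad( * )$$ Moreover, the GHZ state is the unique equatorial probe state achieving $( * )$, up to local unitaries commuting with $\sigma_z$: if $|\psi_0\rangle\in(\mathbb{C}^2)^{\otimes N}$ is an equatorial normalised pure probe state satisfying $( * )$, then $|\psi_0\rangle=(V_1\otimes\cdots\otimes V_N)|\Phi_N^+\rangle$ for some unitaries $V_1,\dots,V_N$ on $\mathbb{C}^2$, each commuting with $\sigma_z$.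
   Context: Setting: $N$ sensors each hold one qubit of a normalised pure probe state $|\psi_0\rangle\in(\mathbb{C}^2)^{\otimes N}$. Let $|0\rangle,|1\rangle$ be the computational basis of $\mathbb{C}^2$, let $\sigma_z=\mathrm{diag}(1,-1)$ be the Pauli $Z$ operator in this basis, and let $\sigma_z^{(j)}=I\otimes\cdots\otimes\sigma_z\otimes\cdots\otimes I$ with $\sigma_z$ acting on the $j$-th qubit. The encoded state is $|\psi(\boldsymbol{\theta})\rangle=\exp\left(-\frac{i}{2}\sum_{j=1}^N\theta_j\sigma_z^{(j)}\right)|\psi_0\rangle$ with $\boldsymbol{\theta}=(\theta_1,\dots,\theta_N)\in[0,2\pi)^N$. Quantum Fisher information matrix (QFIM): with $\rho(\boldsymbol{\theta})=|\psi(\boldsymbol{\theta})\rangle\langle\psi(\boldsymbol{\theta})|$, $[\mathcal{F}_Q(\boldsymbol{\theta})]_{ij}=\frac12\mathrm{Tr}[\rho(\boldsymbol{\theta})\{L_i,L_j\}]$, where $\{A,B\}=AB+BA$ and $L_i$ is the symmetric logarithmic derivative, defined by $\partial\rho(\boldsymbol{\theta})/\partial\theta_i=\{L_i,\rho(\boldsymbol{\theta})\}/2$. For this encoding the QFIM is given by the known formula (which may be taken as its definition) $$[\mathcal{F}_Q(\boldsymbol{\theta})]_{ij}=\langle\sigma_z^{(i)}\sigma_z^{(j)}\rangle-\langle\sigma_z^{(i)}\rangle\langle\sigma_z^{(j)}\rangle,\qquad \langle A\rangle=\langle\psi_0|A|\psi_0\rangle.$$ For $\boldsymbol{u}\in\mathbb{R}^N$,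 the quantum Fisher information for $\boldsymbol{u}^\top\boldsymbol{\theta}$ is $\mathcal{F}_Q(\boldsymbol{u}^\top\boldsymbol{\theta})=\boldsymbol{u}^\top\mathcal{F}_Q(\boldsymbol{\theta})\boldsymbol{u}$. The probe state $|\psi_0\rangle$ is called equatorial if $\langle\sigma_z^{(j)}\rangle=0$ for all $j$. *)

theory Defs
  imports "HOL-Analysis.Analysis"
begin

text \<open>
  The sensors are the elements of a finite type \<open>'n\<close>, so \<open>N = CARD('n)\<close>.  A qubit is a vector in
  \<open>complex ^ 2\<close> whose coordinates \<open>0\<close> and \<open>1\<close> belong to the computational basis vectors; since
  \<open>2 = 0\<close> holds in the index type \<open>2\<close>, the construction \<open>vector [a, b]\<close> would list the
  coordinate \<open>1\<close> first and is avoided.  The \<open>N\<close>-qubit space has the coordinates \<open>'n \<Rightarrow> 2\<close>,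
  i.e. the bit strings labelling the product basis.
\<close>

type_synonym qubit = "complex ^ 2"
type_synonym qubit_op = "complex ^ 2 ^ 2"
type_synonym 'n state = "complex ^ ('n \<Rightarrow> 2)"
type_synonym 'n operator = "complex ^ ('n \<Rightarrow> 2) ^ ('n \<Rightarrow> 2)"

definition ket0 :: qubit where
  "ket0 = axis 0 1"

definition ket1 :: qubit where
  "ket1 = axis 1 1"

definition tensor_vec :: "('n::finite \<Rightarrow> qubit) \<Rightarrow> 'n state" where
  "tensor_vec v = (\<chi> x. \<Prod>j\<in>UNIV. v j $ x j)"

definition tensor_op :: "('n::finite \<Rightarrow> qubit_op) \<Rightarrow> 'n operator" where
  "tensor_op A = (\<chi> x y. \<Prod>j\<in>UNIV. A j $ x j $ y j)"

definition sigma_z :: qubit_op where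
  "sigma_z = (\<chi> a b. if a = b then (if a = 0 then 1 else - 1) else 0)"

definition sigma_z_at :: "'n::finite \<Rightarrow> 'n operator" where
  "sigma_z_at j = tensor_op (\<lambda>k. if k = j then sigma_z else mat 1)"

definition braket :: "complex ^ 'i \<Rightarrow> complex ^ 'i \<Rightarrow> complex" where
  "braket \<phi> \<psi> = (\<Sum>i\<in>UNIV. cnj (\<phi> $ i) * \<psi> $ i)"

definition expectation :: "'n::finite state \<Rightarrow> 'n operator \<Rightarrow> complex" where
  "expectation \<psi> A = braket \<psi> (A *v \<psi>)"

definition adjoint_mat :: "complex ^ 'i ^ 'i \<Rightarrow> complex ^ 'i ^ 'i" where
  "adjoint_mat A = (\<chi> i j. cnj (A $ j $ i))"

definition unitary_mat :: "complex ^ 'i ^ 'i \<Rightarrow> bool" where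
  "unitary_mat U \<longleftrightarrow> adjoint_mat U ** U = mat 1 \<and> U ** adjoint_mat U = mat 1"

text \<open>
  The quantum Fisher information matrix of the family
  \<open>exp (- (\<i>/2) \<Sum>\<^sub>j \<theta>\<^sub>j \<sigma>\<^sub>z\<^sup>(\<^sup>j\<^sup>)) \<psi>\<close>, by its closed form for this encoding.  It does not depend
  on \<open>\<theta>\<close>, so it is a function of the probe state alone.  Its entries, which are real for every
  \<open>\<psi>\<close>, are kept in the type of the expectation values so that nothing is projected away.
\<close>

definition qfim :: "'n::finite state \<Rightarrow> complex ^ 'n ^ 'n" where
  "qfim \<psi> = (\<chi> i j. expectation \<psi> (sigma_z_at i ** sigma_z_at j)
                     - expectation \<psi> (sigma_z_at i) * expectation \<psi> (sigma_z_at j))"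

definition qfi :: "'n::finite state \<Rightarrow> real ^ 'n \<Rightarrow> complex" where
  "qfi \<psi> u = (\<Sum>i\<in>UNIV. \<Sum>j\<in>UNIV. of_real (u $ i) * qfim \<psi> $ i $ j * of_real (u $ j))"

definition equatorial :: "'n::finite state \<Rightarrow> bool" where
  "equatorial \<psi> \<longleftrightarrow> (\<forall>j. expectation \<psi> (sigma_z_at j) = 0)"

definition ghz :: "'n::finite state" where
  "ghz = of_real (1 / sqrt 2) *s (tensor_vec (\<lambda>_. ket0) + tensor_vec (\<lambda>_. ket1))"

definition w_hat :: "real ^ 'n" where
  "w_hat = (\<chi> i. 1 / sqrt (real CARD('n)))"

definition concentrates_qfi :: "'n::finite state \<Rightarrow> bool" where
  "concentrates_qfi \<psi> \<longleftrightarrow>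
     qfi \<psi> w_hat = of_nat CARD('n) \<and>
     (\<forall>v :: real ^ 'n. norm v = 1 \<and> orthogonal v w_hat \<longrightarrow> qfi \<psi> v = 0)"

end

theory Submission
  imports Defs
begin

text \<open>
  All \<open>\<sigma>\<^sub>z\<^sup>(\<^sup>j\<^sup>)\<close> are diagonal in the computational basis, so for an equatorial \<open>\<psi>\<close> the Fisher
  information of \<open>u\<close> is the mean of \<open>(\<Sum>\<^sub>i u\<^sub>i s(x\<^sub>i))\<^sup>2\<close> over bit strings \<open>x\<close> drawn with
  probability \<open>\<bar>\<psi>\<^sub>x\<bar>\<^sup>2\<close>, where \<open>s(0) = 1\<close> and \<open>s(1) = - 1\<close>.  If it vanishes in each direction
  \<open>(e\<^sub>i - e\<^sub>j) / \<surd>2\<close>, then only the two constant strings carry weight; equatoriality gives them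
  weight \<open>1/2\<close> each, and the two remaining phases are absorbed by a diagonal unitary on one qubit.
\<close>

definition zsign :: "2 \<Rightarrow> real" where
  "zsign b = (if b = 0 then 1 else - 1)"

definition diag_mat :: "('a \<Rightarrow> complex) \<Rightarrow> complex ^ 'a ^ 'a" where
  "diag_mat d = (\<chi> x y. if x = y then d x else 0)"

lemma bit_cases: "(b::2) = 0 \<or> b = 1"
  using exhaust_2[of b] by auto

lemma zsign_simps [simp]: "zsign 0 = 1" "zsign 1 = - 1"
  by (auto simp: zsign_def)

lemma zsign_eq_iff [simp]: "zsign a = zsign b \<longleftrightarrow> a = b"
  using bit_cases[of a] bit_cases[of b] by auto

lemma diag_mat_vector_mult: "(diag_mat d *v \<psi>) $ x = d x * \<psi> $ x"
  by (simp add: diag_mat_def matrix_vector_mult_def if_distrib[of "\<lambda>c. c * _"] cong: if_cong)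

lemma diag_mat_mult: "diag_mat d ** diag_mat e = diag_mat (\<lambda>x. d x * e x)"
  by (auto simp: diag_mat_def matrix_matrix_mult_def vec_eq_iff if_distrib[of "\<lambda>c. c * _"]
      cong: if_cong)

lemma adjoint_diag_mat: "adjoint_mat (diag_mat d) = diag_mat (\<lambda>x. cnj (d x))"
  by (auto simp: adjoint_mat_def diag_mat_def vec_eq_iff)

lemma mat_1_eq_diag_mat: "mat 1 = diag_mat (\<lambda>_. 1)"
  by (simp add: mat_def diag_mat_def)

lemma unitary_diag_mat:
  assumes "\<And>x. cmod (d x) = 1"
  shows "unitary_mat (diag_mat d)"
proof -
  have "d x * cnj (d x) = 1" for x
    using assms[of x] by (simp add: complex_norm_square[symmetric])
  then show ?thesis
    by (simp add: unitary_mat_def adjoint_diag_mat diag_mat_mult mat_1_eq_diag_mat mult.commute)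
qed

lemma sigma_z_eq_diag_mat: "sigma_z = diag_mat (\<lambda>b. of_real (zsign b))"
  by (auto simp: sigma_z_def diag_mat_def vec_eq_iff zsign_def)

text \<open>If two strings differ, they differ at some sensor, and the off-diagonal entry there is a
  zero factor of the product.\<close>

lemma tensor_op_diag_mat:
  fixes d :: "'n::finite \<Rightarrow> 2 \<Rightarrow> complex"
  shows "tensor_op (\<lambda>k. diag_mat (d k)) = diag_mat (\<lambda>x. \<Prod>k\<in>UNIV. d k (x k))"
  by (auto simp: tensor_op_def diag_mat_def vec_eq_iff fun_eq_iff)

lemma sigma_z_at_eq_diag_mat:
  "sigma_z_at (j::'n::finite) = diag_mat (\<lambda>x. of_real (zsign (x j)))"
proof -
  have "sigma_z_at j =
      tensor_op (\<lambda>k. diag_mat (\<lambda>b. if k = j then of_real (zsign b) else 1))"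
    by (auto simp: sigma_z_at_def sigma_z_eq_diag_mat mat_1_eq_diag_mat
        intro!: arg_cong[of _ _ tensor_op])
  then show ?thesis
    by (simp add: tensor_op_diag_mat)
qed

text \<open>A real symbol \<open>f\<close> makes the complex expectation an embedded real, so that
  positivity arguments apply later.\<close>

lemma expectation_diag_mat:
  "expectation \<psi> (diag_mat (\<lambda>x. of_real (f x))) = of_real (\<Sum>x\<in>UNIV. (cmod (\<psi> $ x))\<^sup>2 * f x)"
  unfolding expectation_def braket_def diag_mat_vector_mult of_real_sum
  by (rule sum.cong) (simp_all add: complex_norm_square mult_ac del: of_real_power)

lemma expectation_sigma_z_at:
  "expectation \<psi> (sigma_z_at j) = of_real (\<Sum>x\<in>UNIV. (cmod (\<psi> $ x))\<^sup>2 * zsign (x j))"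
  by (simp add: sigma_z_at_eq_diag_mat expectation_diag_mat del: of_real_sum)

text \<open>The product of means in \<open>qfim\<close> vanishes, leaving the correlations of signs.
  Once the sum over strings is moved outermost, the double sum over sensors factors into a
  square.\<close>

lemma qfi_equatorial:
  fixes \<psi> :: "'n::finite state"
  assumes "equatorial \<psi>"
  shows "qfi \<psi> u = of_real (\<Sum>x\<in>UNIV. (cmod (\<psi> $ x))\<^sup>2 * (\<Sum>i\<in>UNIV. u $ i * zsign (x i))\<^sup>2)"
proof -
  have q: "qfim \<psi> $ i $ j = of_real (\<Sum>x\<in>UNIV. (cmod (\<psi> $ x))\<^sup>2 * (zsign (x i) * zsign (x j)))"
    for i j
    using assms
    by (simp add: qfim_def equatorial_def sigma_z_at_eq_diag_mat diag_mat_mult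
        expectation_diag_mat del: of_real_sum flip: of_real_mult)
  have "qfi \<psi> u = of_real (\<Sum>i\<in>UNIV. \<Sum>j\<in>UNIV. \<Sum>x\<in>UNIV.
      u $ i * ((cmod (\<psi> $ x))\<^sup>2 * (zsign (x i) * zsign (x j))) * u $ j)"
    by (simp add: qfi_def q sum_distrib_left sum_distrib_right)
  also have "(\<Sum>i\<in>UNIV. \<Sum>j\<in>UNIV. \<Sum>x\<in>UNIV.
      u $ i * ((cmod (\<psi> $ x))\<^sup>2 * (zsign (x i) * zsign (x j))) * u $ j)
    = (\<Sum>i\<in>UNIV. \<Sum>x\<in>UNIV. \<Sum>j\<in>UNIV.
      u $ i * ((cmod (\<psi> $ x))\<^sup>2 * (zsign (x i) * zsign (x j))) * u $ j)"
    by (intro sum.cong refl sum.swap)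
  also have "\<dots> = (\<Sum>x\<in>UNIV. \<Sum>i\<in>UNIV. \<Sum>j\<in>UNIV.
      u $ i * ((cmod (\<psi> $ x))\<^sup>2 * (zsign (x i) * zsign (x j))) * u $ j)"
    by (rule sum.swap)
  also have "\<dots> = (\<Sum>x\<in>UNIV. (cmod (\<psi> $ x))\<^sup>2 * (\<Sum>i\<in>UNIV. u $ i * zsign (x i))\<^sup>2)"
    by (simp add: power2_eq_square sum_product sum_distrib_left mult_ac)
  finally show ?thesis .
qed

lemma norm_state_power2: "(norm (\<psi> :: complex ^ 'i::finite))\<^sup>2 = (\<Sum>x\<in>UNIV. (cmod (\<psi> $ x))\<^sup>2)"
  by (simp add: norm_vec_def L2_set_def sum_nonneg)

text \<open>Types are inhabited, so there is at least one sensor at which the two strings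
  differ.\<close>

lemma const_bits_neq [simp]: "(\<lambda>_::'n. 0::2) \<noteq> (\<lambda>_. 1)" "(\<lambda>_::'n. 1::2) \<noteq> (\<lambda>_. 0)"
  by (simp_all add: fun_eq_iff)

lemma tensor_vec_axis: "tensor_vec (\<lambda>_::'n::finite. axis b 1) = axis (\<lambda>_. b) 1"
  by (auto simp: tensor_vec_def axis_def vec_eq_iff fun_eq_iff)

lemma ghz_nth:
  "(ghz :: 'n::finite state) $ x =
     (if x = (\<lambda>_. 0) \<or> x = (\<lambda>_. 1) then of_real (1 / sqrt 2) else 0)"
  unfolding ghz_def ket0_def ket1_def tensor_vec_axis by (auto simp: axis_def)

text \<open>Serves both the GHZ state and, in the uniqueness proof, any state already known to live
  on the constant strings.\<close>

lemma sum_constant_strings: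
  fixes f :: "('n::finite \<Rightarrow> 2) \<Rightarrow> 'b::comm_monoid_add"
  assumes "\<And>x. x \<noteq> (\<lambda>_. 0) \<Longrightarrow> x \<noteq> (\<lambda>_. 1) \<Longrightarrow> f x = 0"
  shows "(\<Sum>x\<in>UNIV. f x) = f (\<lambda>_. 0) + f (\<lambda>_. 1)"
proof -
  have "(\<Sum>x\<in>UNIV. f x) = (\<Sum>x\<in>{\<lambda>_. 0, \<lambda>_. 1}. f x)"
    by (rule sum.mono_neutral_right) (use assms in auto)
  then show ?thesis by simp
qed

lemma sum_cmod_ghz:
  "(\<Sum>x\<in>UNIV. (cmod ((ghz :: 'n::finite state) $ x))\<^sup>2 * f x) = (f (\<lambda>_. 0) + f (\<lambda>_. 1)) / 2"
  by (subst sum_constant_strings) (auto simp: ghz_nth norm_divide power_divide)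

lemma norm_ghz: "norm (ghz :: 'n::finite state) = 1"
proof -
  have "(norm (ghz :: 'n state))\<^sup>2 = 1"
    using sum_cmod_ghz[of "\<lambda>_ :: 'n \<Rightarrow> 2. 1"] by (simp add: norm_state_power2)
  then show ?thesis
    using norm_ge_zero[of "ghz :: 'n state"] by (auto simp: power2_eq_1_iff simp del: norm_ge_zero)
qed

lemma equatorial_ghz: "equatorial ghz"
  by (simp add: equatorial_def expectation_sigma_z_at sum_cmod_ghz del: of_real_sum)

text \<open>The signed sum of \<open>u\<close> is plus or minus its plain sum on the two constant
  strings, so both squares agree and so does their mean.\<close>

lemma qfi_ghz: "qfi ghz u = of_real ((\<Sum>i\<in>UNIV. u $ i)\<^sup>2)"
  unfolding qfi_equatorial[OF equatorial_ghz] sum_cmod_ghz by (simp add: sum_negf)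

lemma orthogonal_w_hat_iff:
  "orthogonal v (w_hat :: real ^ 'n::finite) \<longleftrightarrow> (\<Sum>i\<in>UNIV. v $ i) = 0"
  by (simp add: orthogonal_def inner_vec_def w_hat_def flip: sum_divide_distrib)

lemma concentrates_qfi_ghz: "concentrates_qfi (ghz :: 'n::finite state)"
proof -
  have "(\<Sum>i\<in>UNIV. (w_hat :: real ^ 'n) $ i)\<^sup>2 = real CARD('n)"
    by (simp add: w_hat_def power_divide power_mult_distrib) (simp add: power2_eq_square)
  then show ?thesis
    by (simp add: concentrates_qfi_def qfi_ghz orthogonal_w_hat_iff)
qed

lemma concentrates_qfi_support:
  fixes \<psi> :: "'n::finite state"
  assumes eq: "equatorial \<psi>" and conc: "concentrates_qfi \<psi>" and "x i \<noteq> x j"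
  shows "\<psi> $ x = 0"
proof -
  have "i \<noteq> j" using \<open>x i \<noteq> x j\<close> by auto
  define v :: "real ^ 'n" where "v = (1 / sqrt 2) *\<^sub>R (axis i 1 - axis j 1)"
  \<comment> \<open>Used three times: \<open>f = 1\<close> gives orthogonality to
    \<open>w_hat\<close>, \<open>f = v\<close> gives the norm, and the signs of a string give its
    term in the Fisher information.\<close>
  have s: "(\<Sum>k\<in>UNIV. v $ k * f k) = (f i - f j) / sqrt 2" for f
    by (simp add: v_def axis_def left_diff_distrib sum_subtractf diff_divide_distrib
        if_distrib[of "\<lambda>c. c * _"] if_distrib[of "\<lambda>c. c / _"] cong: if_cong)
  have "orthogonal v w_hat"
    using s[of "\<lambda>_. 1"] by (simp add: orthogonal_w_hat_iff)
  moreover have "norm v = 1"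
  proof -
    have "inner v v = 1"
      using s[of "\<lambda>k. v $ k"] \<open>i \<noteq> j\<close>
      by (simp add: inner_vec_def) (simp add: v_def axis_def real_div_sqrt)
    then show ?thesis by (simp add: norm_eq_1)
  qed
  ultimately have "qfi \<psi> v = 0"
    using conc by (simp add: concentrates_qfi_def)
  then have "(\<Sum>y\<in>UNIV. (cmod (\<psi> $ y))\<^sup>2 * ((zsign (y i) - zsign (y j)) / sqrt 2)\<^sup>2) = 0"
    unfolding qfi_equatorial[OF eq] s of_real_eq_0_iff .
  \<comment> \<open>A vanishing sum of nonnegative terms has only zero terms. The second factor is
    nonzero at \<open>x\<close> because \<open>zsign\<close> is injective, which forces the
    amplitude to vanish.\<close>
  then have "(cmod (\<psi> $ x))\<^sup>2 * ((zsign (x i) - zsign (x j)) / sqrt 2)\<^sup>2 = 0"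
    by (subst (asm) sum_nonneg_eq_0_iff) auto
  then show ?thesis using \<open>x i \<noteq> x j\<close> by simp
qed

lemma ghz_unique:
  fixes \<psi> :: "'n::finite state"
  assumes "norm \<psi> = 1" "equatorial \<psi>" "concentrates_qfi \<psi>"
  shows "\<exists>V. (\<forall>j. unitary_mat (V j) \<and> V j ** sigma_z = sigma_z ** V j) \<and> \<psi> = tensor_op V *v ghz"
proof -
  have supp: "\<psi> $ x = 0" if "x \<noteq> (\<lambda>_. 0)" "x \<noteq> (\<lambda>_. 1)" for x
  proof -
    \<comment> \<open>With only two bit values, these inequalities mean \<open>x i = 1\<close> and
      \<open>x j = 0\<close>.\<close>
    obtain i j where "x i \<noteq> 0" "x j \<noteq> 1" using \<open>x \<noteq> (\<lambda>_. 0)\<close> \<open>x \<noteq> (\<lambda>_. 1)\<close> by blast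
    then have "x i \<noteq> x j" using bit_cases by metis
    then show ?thesis by (rule concentrates_qfi_support[OF assms(2,3)])
  qed
  define p where "p = (\<lambda>b::2. (cmod (\<psi> $ (\<lambda>_. b)))\<^sup>2)"
  have "p 0 + p 1 = (norm \<psi>)\<^sup>2"
    unfolding norm_state_power2 p_def by (rule sum_constant_strings[symmetric]) (simp add: supp)
  \<comment> \<open>Every sensor has sign 1 on one constant string and -1 on the other, so the
    vanishing mean of any single sensor is this difference.\<close>
  moreover have "p 0 - p 1 = 0"
  proof -
    have "(\<Sum>x\<in>UNIV. (cmod (\<psi> $ x))\<^sup>2 * zsign (x j)) = 0" for j
      using assms(2) unfolding equatorial_def expectation_sigma_z_at of_real_eq_0_iff by blast
    then show ?thesis
      by (subst (asm) sum_constant_strings) (auto simp: p_def supp)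
  qed
  ultimately have "p b = 1 / 2" for b
    using assms(1) bit_cases[of b] by auto
  then have cmod: "cmod (\<psi> $ (\<lambda>_. b)) = 1 / sqrt 2" for b
    unfolding p_def by (metis norm_ge_zero real_sqrt_abs2 real_sqrt_divide real_sqrt_one
        real_sqrt_unique)
  \<comment> \<open>An arbitrary sensor \<open>k\<close> absorbs both phases; the others get the
    identity. The factor \<open>sqrt 2\<close> in \<open>d\<close> cancels the modulus of the
    amplitudes, so the entries are unimodular.\<close>
  obtain k :: 'n where True by blast
  define d where "d = (\<lambda>j b. if j = k then of_real (sqrt 2) * \<psi> $ (\<lambda>_. b) else 1)"
  define V where "V = (\<lambda>j. diag_mat (d j))"
  have "cmod (d j b) = 1" for j b
    by (simp add: d_def norm_mult cmod)
  then have "unitary_mat (V j)" for j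
    unfolding V_def by (rule unitary_diag_mat)
  moreover have "V j ** sigma_z = sigma_z ** V j" for j
    by (simp add: V_def sigma_z_eq_diag_mat diag_mat_mult mult.commute)
  moreover have "\<psi> = tensor_op V *v ghz"
  proof -
    have "\<psi> $ x = (tensor_op V *v ghz) $ x" for x
    proof -
      have "(\<Prod>j\<in>UNIV. d j (x j)) = of_real (sqrt 2) * \<psi> $ (\<lambda>_. x k)"
        by (simp add: d_def)
      then have "(tensor_op V *v ghz) $ x = of_real (sqrt 2) * \<psi> $ (\<lambda>_. x k) * ghz $ x"
        by (simp add: V_def tensor_op_diag_mat diag_mat_vector_mult)
      \<comment> \<open>On a constant string, \<open>x\<close> is the string repeating
        \<open>x k\<close> and the factor \<open>sqrt 2\<close> cancels the GHZ amplitude; elsewhere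
        both sides are 0.\<close>
      then show ?thesis by (auto simp: ghz_nth supp)
    qed
    then show ?thesis by (simp add: vec_eq_iff)
  qed
  ultimately show ?thesis by (intro exI[of _ V] conjI allI)
qed

theorem corollary2:
  shows "(norm (ghz :: 'n::finite state) = 1 \<and> equatorial (ghz :: 'n state)
            \<and> concentrates_qfi (ghz :: 'n state)) \<and>
         (\<forall>\<psi> :: 'n state. norm \<psi> = 1 \<and> equatorial \<psi> \<and> concentrates_qfi \<psi> \<longrightarrow>
            (\<exists>V :: 'n \<Rightarrow> qubit_op.
               (\<forall>j. unitary_mat (V j) \<and> V j ** sigma_z = sigma_z ** V j) \<and>
               \<psi> = tensor_op V *v ghz))"
  using norm_ghz equatorial_ghz concentrates_qfi_ghz ghz_unique by blast

end
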